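(* Throughout, for a real $\mathrm{w}$, say that a sequence $(b_n)_{n\ge1}$ of positive reals satisfies $(\ast)_{\mathrm{w}}$ if $b_n=1-\frac{\mathrm{w}}{n^2}+\mathcal{O}\left(\frac{1}{n^{2+\zeta}}\right)$ as $n\to\infty$ for some $\zeta>0$; let $R$ be the matrix associated with $(b_n)$ as in the context. (i) If $\mathrm{w}>1/8$ and $(b_n)$ satisfies $(\ast)_{\mathrm{w}}$, the equation $Rw=w-\mathbf{1}_{p=1}$ has no positive solution. (ii) For any $\mathrm{w}<1/8$, there exists a positive sequence $(b_n)$ satisfying $(\ast)_{\mathrm{w}}$ such that the equation $Rw=w-\mathbf{1}_{p=1}$ has no positive solution. (iii) For any $\mathrm{w}<1/8$, there exists a positive sequence $(b_n)$ satisfying $(\ast)_{\mathrm{w}}$ such that the equation $Rw=w-\mathbf{1}_{p=1}$ has a positive solution. (iv) For the sequence $b_n=1-\frac{\mathrm{w}}{n^2}$ for all $n\ge1$, there exists $0<\mathrm{w}_c\le1/8$ such that for any $\mathrm{w}<\mathrm{w}_c$ the equation $Rw=w-\mathbf{1}_{p=1}$ has a positive solution.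
   Context: For a sequence $(b_n)_{n\ge1}$ of positive reals, $R$ acts on sequences $w=(w_p)_{p\ge1}$ by $(Rw)_1=\frac{w_2}{2\sqrt{b_1b_2}}$ and $(Rw)_p=\frac{w_{p+1}}{2\sqrt{b_pb_{p+1}}}+\frac{w_{p-1}}{2\sqrt{b_pb_{p-1}}}$ for $p>1$. The equation $Rw=w-\mathbf{1}_{p=1}$ means $(Rw)_p=w_p-\mathbf{1}_{p=1}$ for all $p\ge1$; a positive solution is one with $w_p>0$ for all $p\ge1$. *)

theory Defs
  imports Complex_Main "HOL-Library.Landau_Symbols"
begin

text \<open>
  A sequence indexed by the positive integers is a function on \<^typ>\<open>nat\<close> whose value at
  \<open>0\<close> is never used: every condition below is restricted to indices \<open>\<ge> 1\<close>.
\<close>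

definition R :: "(nat \<Rightarrow> real) \<Rightarrow> (nat \<Rightarrow> real) \<Rightarrow> nat \<Rightarrow> real" where
  "R b u p =
     (if p = 1 then u 2 / (2 * sqrt (b 1 * b 2))
      else u (p + 1) / (2 * sqrt (b p * b (p + 1))) + u (p - 1) / (2 * sqrt (b p * b (p - 1))))"

definition positive_seq :: "(nat \<Rightarrow> real) \<Rightarrow> bool" where
  "positive_seq u \<longleftrightarrow> (\<forall>n\<ge>1. u n > 0)"

definition star_condition :: "real \<Rightarrow> (nat \<Rightarrow> real) \<Rightarrow> bool" where
  "star_condition w b \<longleftrightarrow>
     (\<exists>\<zeta>>0. (\<lambda>n. b n - (1 - w / real n ^ 2)) \<in> O(\<lambda>n. 1 / real n powr (2 + \<zeta>)))"

definition is_solution :: "(nat \<Rightarrow> real) \<Rightarrow> (nat \<Rightarrow> real) \<Rightarrow> bool" where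
  "is_solution b u \<longleftrightarrow> (\<forall>p\<ge>1. R b u p = u p - (if p = 1 then 1 else 0))"

definition has_positive_solution :: "(nat \<Rightarrow> real) \<Rightarrow> bool" where
  "has_positive_solution b \<longleftrightarrow> (\<exists>u. positive_seq u \<and> is_solution b u)"

end

theory Submission
  imports Defs "HOL-Analysis.Summation_Tests" "HOL-Real_Asymp.Real_Asymp"
begin

text \<open>
  Dividing \<open>w\<^sub>p\<close> by \<open>sqrt b\<^sub>p\<close> turns the equation into the three-term recurrence
  \<open>v\<^sub>p\<^sub>+\<^sub>1 + v\<^sub>p\<^sub>-\<^sub>1 = 2 b\<^sub>p v\<^sub>p\<close>, the inhomogeneity becoming the initial value \<open>v\<^sub>0 > 0\<close>. Then the ratios
  \<open>r\<^sub>p = v\<^sub>p / v\<^sub>p\<^sub>-\<^sub>1\<close> satisfy the Riccati recursion \<open>r\<^sub>p\<^sub>+\<^sub>1 = 2 b\<^sub>p - 1 / r\<^sub>p\<close>, whose monotonicity makes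
  a positive supersolution sufficient for a positive solution. The ratios \<open>1 + a / n\<close> solve it
  exactly for \<open>b\<^sub>n = 1 - w / ((n + 1) (n + a))\<close> with \<open>a (1 - a) = 2 w\<close>, which has a real root
  \<open>a\<close> when \<open>w \<le> 1/8\<close>; this gives (iii), and (iv) by comparison. For (ii) it is enough to make two
  consecutive terms of \<open>b\<close> small. For (i), \<open>v\<close> is eventually concave, hence
  nondecreasing, and \<open>y\<^sub>n = n (r\<^sub>n - 1) \<ge> 0\<close> satisfies
  \<open>y\<^sub>n\<^sub>+\<^sub>1 - y\<^sub>n \<le> (y\<^sub>n - y\<^sub>n\<^sup>2) / (n + y\<^sub>n) - c / n \<le> - (c - 1/4) / n\<close> for some \<open>c > 1/4\<close>, which contradicts
  the divergence of the harmonic series.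
\<close>

section \<open>Reduction to a three-term recurrence\<close>

lemma has_positive_solution_iff_recurrence:
  assumes "positive_seq b"
  shows "has_positive_solution b \<longleftrightarrow>
    (\<exists>v. (\<forall>n. v n > 0) \<and> (\<forall>n. v (Suc (Suc n)) + v n = 2 * b (Suc n) * v (Suc n)))"
proof
  have b: "b n > 0" if "n \<ge> 1" for n
    using assms that by (auto simp: positive_seq_def)
  assume "has_positive_solution b"
  then obtain u where u: "\<And>n. n \<ge> 1 \<Longrightarrow> u n > 0" and
    eq: "\<And>n. n \<ge> 1 \<Longrightarrow> R b u n = u n - (if n = 1 then 1 else 0)"
    by (auto simp: has_positive_solution_def positive_seq_def is_solution_def)
  \<comment> \<open>Multiplying the equation at \<open>p = 1\<close> by
    \<open>2 * sqrt (b 1)\<close> turns its source term 1 into \<open>2 * sqrt (b 1)\<close>, which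
    takes the place of \<open>v 0\<close>.\<close>
  define v where "v n = (if n = 0 then 2 * sqrt (b 1) else u n / sqrt (b n))" for n
  have "v n > 0" for n
    using u[of n] b[of n] b[of 1] by (auto simp: v_def)
  moreover have "v (Suc (Suc n)) + v n = 2 * b (Suc n) * v (Suc n)" for n
  proof -
    have sq: "b (Suc n) = sqrt (b (Suc n)) * sqrt (b (Suc n))"
      using b[of "Suc n"] by simp
    have pos: "sqrt (b (Suc n)) > 0" "sqrt (b (Suc (Suc n))) > 0"
      using b[of "Suc n"] b[of "Suc (Suc n)"] by simp_all
    have "v (Suc (Suc n)) + v n = 2 * sqrt (b (Suc n)) * u (Suc n)"
    proof (cases n)
      case 0
      then show ?thesis
        using eq[of 1] pos by (simp add: R_def v_def real_sqrt_mult field_simps numeral_2_eq_2)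
    next
      case (Suc m)
      then have "sqrt (b n) > 0"
        using b[of n] by simp
      then show ?thesis
        using eq[of "Suc n"] pos Suc by (simp add: R_def v_def real_sqrt_mult field_simps)
    qed
    also have "\<dots> = 2 * b (Suc n) * v (Suc n)"
    proof -
      have "sqrt (b (Suc n)) * v (Suc n) = u (Suc n)"
        using pos(1) by (simp add: v_def)
      then show ?thesis
        using sq by (metis mult.assoc)
    qed
    finally show ?thesis .
  qed
  ultimately show "\<exists>v. (\<forall>n. v n > 0) \<and>
      (\<forall>n. v (Suc (Suc n)) + v n = 2 * b (Suc n) * v (Suc n))"
    by blast
next
  have b: "b n > 0" if "n \<ge> 1" for n
    using assms that by (auto simp: positive_seq_def)
  assume "\<exists>v. (\<forall>n. v n > 0) \<and> (\<forall>n. v (Suc (Suc n)) + v n = 2 * b (Suc n) * v (Suc n))"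
  then obtain v where v: "\<And>n. v n > 0"
    and rec: "\<And>n. v (Suc (Suc n)) + v n = 2 * b (Suc n) * v (Suc n)"
    by blast
  \<comment> \<open>The recurrence is linear and homogeneous, so \<open>v\<close> can be rescaled to
    have the initial value that encodes the source term 1.\<close>
  define k where "k = 2 * sqrt (b 1) / v 0"
  have k: "k > 0"
    using b[of 1] v[of 0] by (simp add: k_def)
  define u where "u n = k * sqrt (b n) * v n" for n
  have "R b u n = u n - (if n = 1 then 1 else 0)" if n: "n \<ge> 1" for n
  proof -
    obtain m where m: "n = Suc m"
      using n by (cases n) auto
    define s where "s = sqrt (b n)"
    have s: "s > 0" "b n = s * s" and sqrt_b: "sqrt (b n) = s"
      using b[OF n] by (simp_all add: s_def)
    have rec': "v (Suc n) = 2 * (s * s) * v n - v m"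
      using rec[of m] s(2) by (simp add: m)
    have up: "u (Suc n) / (2 * sqrt (b n * b (Suc n))) = k * v (Suc n) / (2 * s)"
      using b[of "Suc n"] s(1) by (simp add: u_def real_sqrt_mult sqrt_b)
    show ?thesis
    proof (cases m)
      case 0
      then have "R b u n = k * v (Suc n) / (2 * s)"
        using up by (simp add: R_def m numeral_2_eq_2)
      also have "\<dots> = u n - k * v 0 / (2 * s)"
        using s(1) 0 by (simp add: rec' u_def sqrt_b field_simps)
      also have "k * v 0 / (2 * s) = 1"
        using v[of 0] s(1) sqrt_b by (simp add: k_def m 0)
      finally show ?thesis
        by (simp add: m 0)
    next
      case (Suc l)
      have "u m / (2 * sqrt (b n * b m)) = k * v m / (2 * s)"
        using b[of m] Suc s(1) by (simp add: u_def real_sqrt_mult sqrt_b)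
      then have "R b u n = k * v (Suc n) / (2 * s) + k * v m / (2 * s)"
        using up by (simp add: R_def m Suc)
      also have "\<dots> = u n"
        using s(1) by (simp add: rec' u_def sqrt_b field_simps)
      finally show ?thesis
        by (simp add: m Suc)
    qed
  qed
  moreover have "u n > 0" if "n \<ge> 1" for n
    using b[OF that] v k by (simp add: u_def)
  ultimately show "has_positive_solution b"
    unfolding has_positive_solution_def positive_seq_def is_solution_def by blast
qed

section \<open>Existence by Riccati comparison\<close>

text \<open>Since \<open>t \<mapsto> 2 * b (Suc n) - 1 / t\<close> is increasing for positive
  \<open>t\<close>, the exact Riccati orbit started at \<open>s 0\<close> stays above
  \<open>s\<close>, hence positive. Its partial products solve the recurrence.\<close>

lemma has_positive_solution_if_Riccati_supersolution:
  assumes b: "positive_seq b"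
    and s: "\<And>n. s n > 0"
    and super: "\<And>n. s (Suc n) \<le> 2 * b (Suc n) - 1 / s n"
  shows "has_positive_solution b"
proof -
  \<comment> \<open>Here \<open>r n\<close> plays the role of \<open>v (Suc n) / v n\<close>, so
    indices are one lower than for the ratios in the overview.\<close>
  define r where "r = rec_nat (s 0) (\<lambda>n t. 2 * b (Suc n) - 1 / t)"
  have r0: "r 0 = s 0" and rSuc: "r (Suc n) = 2 * b (Suc n) - 1 / r n" for n
    by (simp_all add: r_def)
  have r_ge: "r n \<ge> s n" for n
  proof (induction n)
    case (Suc n)
    have "1 / r n \<le> 1 / s n"
      using Suc s[of n] by (simp add: frac_le)
    then show ?case
      using super[of n] by (simp add: rSuc)
  qed (simp add: r0)
  have r: "r n > 0" for n
    using r_ge[of n] s[of n] by linarith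
  define v where "v n = (\<Prod>i<n. r i)" for n
  have "v (Suc (Suc n)) + v n = 2 * b (Suc n) * v (Suc n)" for n
    using r[of n] by (simp add: v_def rSuc field_simps)
  moreover have "v n > 0" for n
    using r by (simp add: v_def prod_pos)
  ultimately show ?thesis
    using has_positive_solution_iff_recurrence[OF b] by blast
qed

lemma has_positive_solution_if_ge:
  assumes "a > 0" and b: "positive_seq b"
    and ge: "\<And>n. n \<ge> 1 \<Longrightarrow> b n \<ge> 1 - a * (1 - a) / 2 / ((real n + 1) * (real n + a))"
  shows "has_positive_solution b"
proof (rule has_positive_solution_if_Riccati_supersolution[OF b])
  fix n :: nat
  show "1 + a / (real n + 1) > 0"
    using \<open>a > 0\<close> by (simp add: add_pos_nonneg)
  \<comment> \<open>With equality in the lower bound for \<open>b\<close>, these ratios solve the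
    Riccati recursion exactly; a larger \<open>b\<close> only increases the right-hand side.\<close>
  have "1 + a / (real (Suc n) + 1) =
      2 * (1 - a * (1 - a) / 2 / ((real (Suc n) + 1) * (real (Suc n) + a))) - 1 / (1 + a / (real n + 1))"
  proof -
    define x where "x = real n"
    have pos: "x + 1 + a > 0" "x + 1 > 0" "x + 2 > 0"
      using \<open>a > 0\<close> by (simp_all add: x_def)
    have "1 / (1 + a / (x + 1)) = (x + 1) / (x + 1 + a)"
      using pos by (simp add: field_simps)
    moreover have "1 + a / (x + 2) =
        2 * (1 - a * (1 - a) / 2 / ((x + 2) * (x + 1 + a))) - (x + 1) / (x + 1 + a)"
      using pos by (simp add: divide_simps) (simp add: algebra_simps)
    ultimately show ?thesis
      by (simp add: x_def add.commute add.left_commute)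
  qed
  also have "\<dots> \<le> 2 * b (Suc n) - 1 / (1 + a / (real n + 1))"
    using ge[of "Suc n"] by (intro diff_right_mono mult_left_mono) simp_all
  finally show "1 + a / (real (Suc n) + 1) \<le> 2 * b (Suc n) - 1 / (1 + a / (real n + 1))" .
qed

section \<open>Nonexistence above the threshold\<close>

text \<open>Telescoping would bound the partial sums of the harmonic series by
  \<open>y N / \<delta>\<close>.\<close>

lemma no_nonneg_with_harmonic_decrease:
  fixes y :: "nat \<Rightarrow> real"
  assumes "\<delta> > 0" and nonneg: "\<And>n. n \<ge> N \<Longrightarrow> y n \<ge> 0"
    and decr: "\<And>n. n \<ge> N \<Longrightarrow> y (Suc n) \<le> y n - \<delta> / real n"
  shows False
proof -
  have sum_le: "\<delta> * (\<Sum>i<k. 1 / real (i + N)) \<le> y N - y (k + N)" for k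
  proof (induction k)
    case (Suc k)
    then show ?case
      using decr[of "k + N"] by (simp add: algebra_simps)
  qed simp
  have "summable (\<lambda>i. 1 / real (i + N))"
  proof (rule summableI_nonneg_bounded)
    show "(\<Sum>i<k. 1 / real (i + N)) \<le> y N / \<delta>" for k
      using sum_le[of k] nonneg[of "k + N"] \<open>\<delta> > 0\<close> by (simp add: field_simps)
  qed simp
  then have "summable (\<lambda>i. 1 / real i)"
    using summable_iff_shift[of "\<lambda>i. 1 / real i" N] by simp
  then show False
    using not_summable_harmonic[where 'a = real] by (simp add: inverse_eq_divide)
qed

lemma recurrence_oscillates:
  fixes v b :: "nat \<Rightarrow> real"
  assumes v: "\<And>n. v n > 0"
    and rec: "\<And>n. v (Suc (Suc n)) + v n = 2 * b (Suc n) * v (Suc n)"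
    and "c > 1/4" and le: "\<And>n. n \<ge> N \<Longrightarrow> 2 * b n \<le> 2 - c / real n ^ 2"
  shows False
proof -
  define d where "d n = v (Suc n) - v n" for n
  have d_Suc: "d (Suc n) \<le> d n" if "n \<ge> N" for n
  proof -
    have "2 * b (Suc n) \<le> 2"
      using le[of "Suc n"] that \<open>c > 1/4\<close> by (smt (verit) divide_nonneg_nonneg le_SucI zero_le_power2)
    then have "2 * b (Suc n) * v (Suc n) \<le> 2 * v (Suc n)"
      using v[of "Suc n"] by (intro mult_right_mono) auto
    then show ?thesis
      using rec[of n] by (simp add: d_def)
  qed
  \<comment> \<open>By concavity a negative increment persists, which forces \<open>v\<close> below
    a line of negative slope and so eventually below zero.\<close>
  have d_nonneg: "d n \<ge> 0" if "n \<ge> N" for n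
  proof (rule ccontr)
    assume "\<not> d n \<ge> 0"
    then have neg: "d n < 0"
      by simp
    have d_le: "d (n + k) \<le> d n" for k
    proof (induction k)
      case (Suc k)
      then show ?case
        using d_Suc[of "n + k"] that by simp
    qed simp
    have v_le: "v (n + k) \<le> v n + real k * d n" for k
    proof (induction k)
      case (Suc k)
      then show ?case
        using d_le[of k] by (simp add: d_def algebra_simps)
    qed simp
    obtain k :: nat where "real k * (- d n) > v n"
      using neg reals_Archimedean3[of "- d n"] by auto
    then show False
      using v_le[of k] v[of "n + k"] by simp
  qed
  define y where "y n = real n * d (n - 1) / v (n - 1)" for n
  show False
  proof (rule no_nonneg_with_harmonic_decrease)
    show "c - 1/4 > 0"
      using \<open>c > 1/4\<close> by simp
    show "y n \<ge> 0" if "n \<ge> Suc N" for n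
      using d_nonneg[of "n - 1"] v[of "n - 1"] that by (simp add: y_def)
    show "y (Suc n) \<le> y n - (c - 1/4) / real n" if n: "n \<ge> Suc N" for n
    proof -
      obtain m where m: "n = Suc m"
        using n by (cases n) auto
      define \<rho> where "\<rho> = d m / v m"
      define x where "x = real n"
      have x: "x > 0"
        by (simp add: x_def m)
      have \<rho>: "\<rho> \<ge> 0"
        using d_nonneg[of m] v[of m] n by (simp add: \<rho>_def m)
      have v_n: "v n = (1 + \<rho>) * v m"
        using v[of m] by (simp add: \<rho>_def d_def m field_simps)
      have "d n / v n = 2 * b n - 1 - v m / v n"
        using rec[of m] v[of n] by (simp add: d_def m field_simps)
      also have "v m / v n = 1 / (1 + \<rho>)"
        using v[of m] by (simp add: v_n)
      finally have "d n / v n \<le> 1 - c / x^2 - 1 / (1 + \<rho>)"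
        using le[of n] n by (simp add: x_def)
      also have "\<dots> = \<rho> / (1 + \<rho>) - c / x^2"
        using \<rho> by (simp add: field_simps)
      finally have "(x + 1) * (d n / v n) \<le> (x + 1) * (\<rho> / (1 + \<rho>) - c / x^2)"
        using x by (intro mult_left_mono) auto
      then have "y (Suc n) \<le> (x + 1) * (\<rho> / (1 + \<rho>) - c / x^2)"
        by (simp add: y_def x_def add.commute)
      also have "\<dots> = (x + 1) * \<rho> / (1 + \<rho>) - c / x - c / x^2"
      proof -
        have "(x + 1) * (c / x^2) = c / x + c / x^2"
          using x by (simp add: field_simps power2_eq_square)
        then show ?thesis
          by (simp add: right_diff_distrib)
      qed
      also have "\<dots> \<le> (x + 1) * \<rho> / (1 + \<rho>) - c / x"
        using \<open>c > 1/4\<close> by simp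
      \<comment> \<open>The source of the critical constant: with \<open>y = x * \<rho>\<close> the
        difference of the two main terms is \<open>(y - y^2) / (x + y)\<close>, and
        \<open>y - y^2\<close> is at most 1/4.\<close>
      also have "(x + 1) * \<rho> / (1 + \<rho>) \<le> x * \<rho> + 1 / (4 * x)"
      proof -
        have "0 \<le> (2 * x * \<rho> - 1)\<^sup>2 + \<rho>"
          using \<rho> by simp
        then have "4 * x * ((x + 1) * \<rho>) \<le> (4 * x * x * \<rho> + 1) * (1 + \<rho>)"
          by (simp add: algebra_simps power2_eq_square)
        then show ?thesis
          using x \<rho> by (simp add: divide_simps) (simp add: algebra_simps)
      qed
      also have "x * \<rho> + 1 / (4 * x) - c / x = y n - (c - 1/4) / real n"
        by (simp add: y_def x_def \<rho>_def m diff_divide_distrib)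
      finally show ?thesis
        by simp
    qed
  qed
qed

text \<open>The error term is of smaller order than \<open>1 / n^2\<close>, so the gap
  \<open>w - w'\<close> absorbs it.\<close>

lemma star_condition_eventually_le:
  assumes "star_condition w b" and "w' < w"
  shows "\<forall>\<^sub>F n in sequentially. b n \<le> 1 - w' / real n ^ 2"
proof -
  obtain \<zeta> where "\<zeta> > 0"
    and O: "(\<lambda>n. b n - (1 - w / real n ^ 2)) \<in> O(\<lambda>n. 1 / real n powr (2 + \<zeta>))"
    using assms(1) by (auto simp: star_condition_def)
  have "(\<lambda>n. 1 / real n powr (2 + \<zeta>)) \<in> o(\<lambda>n. 1 / real n ^ 2)"
    using \<open>\<zeta> > 0\<close> by real_asymp
  with O have "(\<lambda>n. b n - (1 - w / real n ^ 2)) \<in> o(\<lambda>n. 1 / real n ^ 2)"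
    by (rule landau_o.big_small_trans)
  from landau_o.smallD[OF this, of "w - w'"]
  show ?thesis
    using \<open>w' < w\<close> by (auto elim!: eventually_mono simp: diff_divide_distrib abs_le_iff)
qed

lemma no_positive_solution_if_gt:
  assumes "w > 1/8" "positive_seq b" "star_condition w b"
  shows "\<not> has_positive_solution b"
proof
  assume "has_positive_solution b"
  then obtain v where v: "\<And>n. v n > 0"
    and rec: "\<And>n. v (Suc (Suc n)) + v n = 2 * b (Suc n) * v (Suc n)"
    using has_positive_solution_iff_recurrence[OF assms(2)] by blast
  obtain w' where w': "1/8 < w'" "w' < w"
    using dense[OF assms(1)] by blast
  obtain N where N: "\<And>n. n \<ge> N \<Longrightarrow> b n \<le> 1 - w' / real n ^ 2"
    using star_condition_eventually_le[OF assms(3) w'(2)] by (auto simp: eventually_sequentially)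
  show False
  proof (rule recurrence_oscillates[of v b "2 * w'" N, OF v rec])
    show "2 * b n \<le> 2 - 2 * w' / real n ^ 2" if "n \<ge> N" for n
      using N[OF that] by simp
  qed (use w'(1) in simp)
qed

section \<open>Sequences below the threshold\<close>

text \<open>The first two recurrence steps give \<open>v 2 + v 0 \<le> v 1\<close> and
  \<open>v 3 + v 1 \<le> v 2\<close>; adding them yields \<open>v 0 + v 3 \<le> 0\<close>.\<close>

lemma no_positive_solution_if_small_start:
  assumes "positive_seq b" "b 1 \<le> 1/2" "b 2 \<le> 1/2"
  shows "\<not> has_positive_solution b"
proof
  assume "has_positive_solution b"
  then obtain v where v: "\<And>n. v n > 0"
    and rec: "\<And>n. v (Suc (Suc n)) + v n = 2 * b (Suc n) * v (Suc n)"
    using has_positive_solution_iff_recurrence[OF assms(1)] by blast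
  have "2 * b 1 * v 1 \<le> 1 * v 1" "2 * b 2 * v 2 \<le> 1 * v 2"
    using assms(2,3) v[of 1] v[of 2] by (intro mult_right_mono; simp)+
  then show False
    using rec[of 0] rec[of 1] v[of 0] v[of 3] by (simp add: numeral_2_eq_2 numeral_3_eq_3)
qed

lemma one_minus_div_square_pos:
  fixes w :: real
  assumes "w < 1" "n \<ge> 1"
  shows "1 - w / real n ^ 2 > 0"
proof -
  have "real n ^ 2 \<ge> 1"
    using assms(2) by simp
  then have "w < real n ^ 2"
    using assms(1) by linarith
  then show ?thesis
    using assms(2) by (simp add: pos_divide_less_eq)
qed

lemma ex_no_positive_solution:
  assumes "w < 1"
  shows "\<exists>b. positive_seq b \<and> star_condition w b \<and> \<not> has_positive_solution b"
proof (intro exI conjI)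
  \<comment> \<open>Changing finitely many terms does not affect the asymptotic condition.\<close>
  define b where "b n = (if n \<le> 2 then 1/2 else 1 - w / real n ^ 2)" for n
  show "positive_seq b"
    using one_minus_div_square_pos[OF assms] by (auto simp: b_def positive_seq_def)
  then show "\<not> has_positive_solution b"
    by (rule no_positive_solution_if_small_start) (simp_all add: b_def)
  have "\<forall>\<^sub>F n in sequentially. b n - (1 - w / real n ^ 2) = 0"
    using eventually_gt_at_top[of 2] by eventually_elim (simp add: b_def)
  then have "(\<lambda>n. b n - (1 - w / real n ^ 2)) \<in> O(\<lambda>n. 1 / real n powr (2 + 1))"
    by (rule landau_o.big.in_cong[THEN iffD2]) simp
  then show "star_condition w b"
    unfolding star_condition_def by (intro exI[of _ 1]) simp
qed

lemma ex_positive_solution: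
  assumes "w < 1/8"
  shows "\<exists>b. positive_seq b \<and> star_condition w b \<and> has_positive_solution b"
proof (intro exI conjI)
  \<comment> \<open>The larger root of \<open>a * (1 - a) = 2 * w\<close>; it stays positive even
    when \<open>w\<close> is negative.\<close>
  define a where "a = (1 + sqrt (1 - 8 * w)) / 2"
  have a: "a \<ge> 1/2"
    using assms by (simp add: a_def)
  have w: "w = a * (1 - a) / 2"
  proof -
    have "(sqrt (1 - 8 * w))\<^sup>2 = 1 - 8 * w"
      using assms by simp
    then show ?thesis
      by (simp add: a_def power2_eq_square field_simps)
  qed
  define b where "b n = 1 - w / ((real n + 1) * (real n + a))" for n
  show pos: "positive_seq b"
    unfolding positive_seq_def
  proof (intro allI impI)
    fix n :: nat assume "n \<ge> 1"
    have "1 \<le> (real n + 1) * (real n + a)"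
      using mult_mono[of 1 "real n + 1" 1 "real n + a"] \<open>n \<ge> 1\<close> a by simp
    then show "b n > 0"
      using assms by (simp add: b_def field_simps)
  qed
  show "has_positive_solution b"
  proof (rule has_positive_solution_if_ge[OF _ pos])
    show "a > 0"
      using a by simp
    show "b n \<ge> 1 - a * (1 - a) / 2 / ((real n + 1) * (real n + a))" for n
      by (simp only: b_def w[symmetric] order_refl)
  qed
  \<comment> \<open>Shifting the two factors of the denominator costs one order, hence
    \<open>\<zeta> = 1\<close>.\<close>
  have "(\<lambda>n. 1 / real n ^ 2 - 1 / ((real n + 1) * (real n + a))) \<in> O(\<lambda>n. 1 / real n powr (2 + 1))"
    using a by real_asymp
  then have "(\<lambda>n. w * (1 / real n ^ 2 - 1 / ((real n + 1) * (real n + a))))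
      \<in> O(\<lambda>n. 1 / real n powr (2 + 1))"
    by (cases "w = 0") simp_all
  then show "star_condition w b"
    unfolding star_condition_def b_def by (intro exI[of _ 1]) (simp add: right_diff_distrib)
qed

text \<open>Comparison with the exact solution for \<open>a = 1/2\<close>, where
  \<open>a * (1 - a) / 2\<close> attains its maximum 1/8. The constant 1/24 comes from
  \<open>(n + 1) * (n + 1/2) \<le> 3 * n^2\<close>, an equality at \<open>n = 1\<close>.\<close>

lemma has_positive_solution_inverse_square:
  assumes "w < 1/24"
  shows "has_positive_solution (\<lambda>n. 1 - w / real n ^ 2)"
proof (rule has_positive_solution_if_ge[of "1/2"])
  show "positive_seq (\<lambda>n. 1 - w / real n ^ 2)"
    using one_minus_div_square_pos[of w] assms by (simp add: positive_seq_def)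
  fix n :: nat assume n: "n \<ge> 1"
  have "w / real n ^ 2 \<le> (1/24) / real n ^ 2"
    using assms by (intro divide_right_mono) auto
  also have "\<dots> \<le> (1/8) / ((real n + 1) * (real n + 1/2))"
  proof -
    define x where "x = real n"
    have x: "x \<ge> 1"
      using n by (simp add: x_def)
    have "3 * x^2 - (x + 1) * (x + 1/2) = (x - 1) * (2 * x + 1/2)"
      by (simp add: power2_eq_square field_simps)
    also have "\<dots> \<ge> 0"
      using x by simp
    finally have "(x + 1) * (x + 1/2) \<le> 3 * x^2"
      by simp
    then show ?thesis
      using x by (simp add: x_def[symmetric] divide_simps)
  qed
  finally show "1 - w / real n ^ 2 \<ge> 1 - 1/2 * (1 - 1/2) / 2 / ((real n + 1) * (real n + 1/2))"
    by simp
qed simp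

theorem proposition2:
  shows "(\<forall>(w::real) b. w > 1/8 \<longrightarrow> positive_seq b \<longrightarrow> star_condition w b \<longrightarrow>
            \<not> has_positive_solution b) \<and>
         (\<forall>w::real. w < 1/8 \<longrightarrow>
            (\<exists>b. positive_seq b \<and> star_condition w b \<and> \<not> has_positive_solution b)) \<and>
         (\<forall>w::real. w < 1/8 \<longrightarrow>
            (\<exists>b. positive_seq b \<and> star_condition w b \<and> has_positive_solution b)) \<and>
         (\<exists>w\<^sub>c::real. 0 < w\<^sub>c \<and> w\<^sub>c \<le> 1/8 \<and>
            (\<forall>w::real. w < w\<^sub>c \<longrightarrow> has_positive_solution (\<lambda>n. 1 - w / real n ^ 2)))"
proof (intro conjI allI impI)
  show "\<exists>w\<^sub>c::real. 0 < w\<^sub>c \<and> w\<^sub>c \<le> 1/8 \<and>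
      (\<forall>w::real. w < w\<^sub>c \<longrightarrow> has_positive_solution (\<lambda>n. 1 - w / real n ^ 2))"
    by (intro exI[of _ "1/24"]) (simp add: has_positive_solution_inverse_square)
qed (use no_positive_solution_if_gt in blast,
     simp_all add: ex_no_positive_solution ex_positive_solution)

end
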